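(* If $\rho(G)>1$, then convergence of $S_r$ to $\mathcal{S}$ may not be finite even when $P$ is a bounded polyhedron containing the origin in its interior. That is: there exist positive integers $n,m$ and $A\in\mathbb{R}^{m\times n}$, $b\in\mathbb{R}^m$, $G\in\mathbb{R}^{n\times n}$ such that $\rho(G)>1$, the polyhedron $P=\{x\in\mathbb{R}^n\mid Ax\le b\}$ is bounded and contains the origin in its interior, and $S_r\setminus\mathcal{S}\ne\emptyset$ for every positive integer $r$.
   Context: Here $\rho(G)$ is the spectral radius of $G$ (largest absolute value of its eigenvalues), $S_r:=\bigcap_{k=0}^{r}\{x\in\mathbb{R}^n \mid AG^kx\le b\}$ for $r\geq 0$, and $\mathcal{S}:=\bigcap_{k=0}^{\infty}\{x\in\mathbb{R}^n \mid AG^kx\le b\}$. Inequalities between vectors are entrywise. Convergence of $S_r$ to $\mathcal S$ is called not finite if $S_r\setminus\mathcal{S}\neq\emptyset$ for all positive integers $r$. *)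

theory Defs
  imports
    "HOL-Analysis.Abstract_Metric_Spaces"
    "HOL-Analysis.L2_Norm"
    "Jordan_Normal_Form.Spectral_Radius"
begin

text \<open>Since the dimensions are quantified inside the statement, \<open>\<real>\<^sup>n\<close> is the set
  \<^term>\<open>carrier_vec n :: real vec set\<close>. Boundedness and interior refer to its Euclidean metric.\<close>

definition euclid_dist :: "nat \<Rightarrow> real vec \<Rightarrow> real vec \<Rightarrow> real" where
  "euclid_dist n x y = L2_set (\<lambda>i. x $ i - y $ i) {..<n}"

lemma Metric_space_euclid_dist: "Metric_space (carrier_vec n) (euclid_dist n)"
proof
  fix x y z :: "real vec"
  show "0 \<le> euclid_dist n x y"
    by (simp add: euclid_dist_def)
  show "euclid_dist n x y = euclid_dist n y x"
    by (simp add: euclid_dist_def L2_set_def power2_commute)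
  show "euclid_dist n x y = 0 \<longleftrightarrow> x = y" if "x \<in> carrier_vec n" "y \<in> carrier_vec n"
    using that by (auto simp: euclid_dist_def L2_set_eq_0_iff)
  show "euclid_dist n x z \<le> euclid_dist n x y + euclid_dist n y z"
    using L2_set_triangle_ineq[of "\<lambda>i. x $ i - y $ i" "\<lambda>i. y $ i - z $ i" "{..<n}"]
    by (simp add: euclid_dist_def)
qed

abbreviation euclid_topology :: "nat \<Rightarrow> real vec topology" where
  "euclid_topology n \<equiv> Metric_space.mtopology (carrier_vec n) (euclid_dist n)"

abbreviation euclid_bounded :: "nat \<Rightarrow> real vec set \<Rightarrow> bool" where
  "euclid_bounded n \<equiv> Metric_space.mbounded (carrier_vec n) (euclid_dist n)"

text \<open>The spectral radius of a real matrix takes all complex eigenvalues into account.\<close>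

abbreviation real_spectral_radius :: "real mat \<Rightarrow> real" where
  "real_spectral_radius G \<equiv> spectral_radius (map_mat complex_of_real G)"

text \<open>The order on \<^typ>\<open>real vec\<close> is entrywise, for vectors of equal dimension.\<close>

definition mat_polyhedron :: "nat \<Rightarrow> real mat \<Rightarrow> real vec \<Rightarrow> real vec set" where
  "mat_polyhedron n A b = {x \<in> carrier_vec n. A *\<^sub>v x \<le> b}"

definition S_upto :: "nat \<Rightarrow> real mat \<Rightarrow> real vec \<Rightarrow> real mat \<Rightarrow> nat \<Rightarrow> real vec set" where
  "S_upto n A b G r = (\<Inter>k\<in>{0..r}. {x \<in> carrier_vec n. (A * (G ^\<^sub>m k)) *\<^sub>v x \<le> b})"

definition S_inf :: "nat \<Rightarrow> real mat \<Rightarrow> real vec \<Rightarrow> real mat \<Rightarrow> real vec set" where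
  "S_inf n A b G = (\<Inter>k. {x \<in> carrier_vec n. (A * (G ^\<^sub>m k)) *\<^sub>v x \<le> b})"

end

theory Submission
  imports Defs
begin

text \<open>
  The counterexample lives on the real line. Take \<open>P = [-1, 1]\<close>, written as \<open>x \<le> 1\<close> and
  \<open>-x \<le> 1\<close>, and let \<open>G\<close> be multiplication by \<open>2\<close>, whose only eigenvalue is \<open>2\<close>. The \<open>k\<close>-th
  constraint \<open>A G\<^sup>k x \<le> b\<close> then says \<open>\<bar>x\<bar> \<le> 2\<^sup>-\<^sup>k\<close>. So \<open>S\<^sub>r = [-2\<^sup>-\<^sup>r, 2\<^sup>-\<^sup>r]\<close> shrinks strictly at
  every step and the limit is \<open>{0}\<close>; the endpoint \<open>2\<^sup>-\<^sup>r\<close> satisfies the constraints up to \<open>r\<close> but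
  violates the next one. Expansion by \<open>G\<close> is what makes every new constraint cut deeper than
  all earlier ones.
\<close>

definition doubling_mat :: "real mat" where
  "doubling_mat = 2 \<cdot>\<^sub>m 1\<^sub>m 1"

definition interval_mat :: "real mat" where
  "interval_mat = mat 2 1 (\<lambda>(i, j). if i = 0 then 1 else - 1)"

definition interval_rhs :: "real vec" where
  "interval_rhs = vec 2 (\<lambda>_. 1)"

lemma doubling_mat_carrier: "doubling_mat \<in> carrier_mat 1 1"
  by (simp add: doubling_mat_def)

lemma doubling_mat_pow: "doubling_mat ^\<^sub>m k = 2 ^ k \<cdot>\<^sub>m 1\<^sub>m 1"
proof (induction k)
  case (Suc k)
  then show ?case
    by (intro eq_matI) (auto simp: doubling_mat_def scalar_prod_def)
qed (auto simp: doubling_mat_def)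

text \<open>The two rows of the system are the upper and the lower half of an absolute value bound.\<close>

lemma interval_constraint_iff:
  assumes "x \<in> carrier_vec 1"
  shows "(interval_mat * doubling_mat ^\<^sub>m k) *\<^sub>v x \<le> interval_rhs \<longleftrightarrow> 2 ^ k * \<bar>x $ 0\<bar> \<le> 1"
proof -
  have "(interval_mat * doubling_mat ^\<^sub>m k) *\<^sub>v x
      = vec 2 (\<lambda>i. if i = 0 then 2 ^ k * x $ 0 else - (2 ^ k * x $ 0))"
    using assms
    by (intro eq_vecI) (auto simp: doubling_mat_pow interval_mat_def scalar_prod_def)
  then have "(interval_mat * doubling_mat ^\<^sub>m k) *\<^sub>v x \<le> interval_rhs \<longleftrightarrow> \<bar>2 ^ k * x $ 0\<bar> \<le> 1"
    by (auto simp: less_eq_vec_def interval_rhs_def less_2_cases_iff abs_le_iff)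
  then show ?thesis
    by (simp add: abs_mult)
qed

lemma interval_polyhedron_eq:
  "mat_polyhedron 1 interval_mat interval_rhs = {x \<in> carrier_vec 1. \<bar>x $ 0\<bar> \<le> 1}"
proof -
  have "interval_mat * doubling_mat ^\<^sub>m 0 = interval_mat"
    by (simp add: doubling_mat_def interval_mat_def)
  then show ?thesis
    using interval_constraint_iff[of _ 0] by (auto simp: mat_polyhedron_def)
qed

lemma euclid_dist_line: "euclid_dist 1 x y = \<bar>x $ 0 - y $ 0\<bar>"
  by (simp add: euclid_dist_def L2_set_def lessThan_Suc)

lemma interval_polyhedron_bounded:
  "euclid_bounded 1 (mat_polyhedron 1 interval_mat interval_rhs)"
proof -
  interpret Metric_space "carrier_vec 1" "euclid_dist 1"
    by (rule Metric_space_euclid_dist)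
  show ?thesis
    unfolding mbounded_def interval_polyhedron_eq
    by (intro exI[of _ "0\<^sub>v 1"] exI[of _ 1]) (auto simp: euclid_dist_line simp del: One_nat_def)
qed

lemma interval_polyhedron_interior:
  "0\<^sub>v 1 \<in> euclid_topology 1 interior_of mat_polyhedron 1 interval_mat interval_rhs"
proof -
  interpret Metric_space "carrier_vec 1" "euclid_dist 1"
    by (rule Metric_space_euclid_dist)
  have "mball (0\<^sub>v 1) 1 \<subseteq> mat_polyhedron 1 interval_mat interval_rhs"
    by (auto simp: interval_polyhedron_eq euclid_dist_line simp del: One_nat_def)
  moreover have "0\<^sub>v 1 \<in> mball (0\<^sub>v 1) 1"
    by (simp del: One_nat_def)
  ultimately show ?thesis
    unfolding interior_of_def using openin_mball by blast
qed

lemma spectral_radius_doubling_mat: "real_spectral_radius doubling_mat > 1"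
proof -
  let ?G = "map_mat complex_of_real doubling_mat"
  have carrier: "?G \<in> carrier_mat 1 1"
    using doubling_mat_carrier by simp
  have "eigenvector ?G (unit_vec 1 0) 2"
    by (auto simp: eigenvector_def doubling_mat_def scalar_prod_def intro!: eq_vecI
        dest: arg_cong[where f = "\<lambda>v :: complex vec. v $ 0"])
  then have "2 \<in> spectrum ?G"
    by (auto simp: spectrum_def eigenvalue_def)
  then have "norm (2 :: complex) \<le> spectral_radius ?G"
    by (intro spectral_radius_mem_max(2)[OF carrier] imageI) auto
  then show ?thesis
    by simp
qed

lemma doubling_convergence_not_finite:
  "S_upto 1 interval_mat interval_rhs doubling_mat r
    - S_inf 1 interval_mat interval_rhs doubling_mat \<noteq> {}"
proof -
  define x :: "real vec" where "x = vec 1 (\<lambda>_. 1 / 2 ^ r)"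
  have x: "x \<in> carrier_vec 1" and x0: "x $ 0 = 1 / 2 ^ r"
    by (simp_all add: x_def)
  have "2 ^ k * \<bar>x $ 0\<bar> \<le> 1" if "k \<le> r" for k
    using that by (simp add: x0)
  then have "x \<in> S_upto 1 interval_mat interval_rhs doubling_mat r"
    using x by (auto simp: S_upto_def interval_constraint_iff)
  moreover have "\<not> 2 ^ Suc r * \<bar>x $ 0\<bar> \<le> 1"
    by (simp add: x0)
  then have "x \<notin> S_inf 1 interval_mat interval_rhs doubling_mat"
    using interval_constraint_iff[OF x, of "Suc r"] unfolding S_inf_def by blast
  ultimately show ?thesis
    by blast
qed

theorem proposition2p4:
  shows "\<exists>(n::nat) (m::nat) (A :: real mat) (b :: real vec) (G :: real mat).
    n > 0 \<and> m > 0 \<and>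
    A \<in> carrier_mat m n \<and> b \<in> carrier_vec m \<and> G \<in> carrier_mat n n \<and>
    real_spectral_radius G > 1 \<and>
    euclid_bounded n (mat_polyhedron n A b) \<and>
    0\<^sub>v n \<in> euclid_topology n interior_of mat_polyhedron n A b \<and>
    (\<forall>r::nat. r > 0 \<longrightarrow> S_upto n A b G r - S_inf n A b G \<noteq> {})"
proof (intro exI conjI allI impI)
  show "interval_mat \<in> carrier_mat 2 1" "interval_rhs \<in> carrier_vec 2"
    by (simp_all add: interval_mat_def interval_rhs_def)
qed (use doubling_mat_carrier spectral_radius_doubling_mat interval_polyhedron_bounded
    interval_polyhedron_interior doubling_convergence_not_finite in auto)

end
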